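(* Let $(S,s)$ be a finite bijective set-theoretic solution to the Pentagon Equation with $s(x,y)=(x\cdot y,\theta_x(y))$, and let $(\overline{S},\overline{s})$ be its retract. Then $(S,s)$ is an extension of $(\overline{S},\overline{s})$ by $X=\ker\theta\cap E(S,\cdot)$, where $\ker\theta=\{x\in S:\theta_x=\mathrm{id}_S\}$. That is, $(S,s)$ is, up to identifying $S$ with $X\times\overline{S}$ via a bijection, equal to $\mathrm{Ext}_X^{\varphi}(\overline{S},\overline{s})$ for some family $\varphi=\{\varphi_a\}_{a\in A}$ of permutations of $X$, where $\overline{S}=A\times G$ is the decomposition of the irretractable solution $(\overline{S},\overline{s})$ described in the context.
   Context: A set-theoretic solution to the Pentagon Equation is a pair $(S,s)$ with $S$ a nonempty set and $s:S\times S\to S\times S$ a map such that $s_{23}s_{13}s_{12}=s_{12}s_{23}$ on $S\times S\times S$, where $s_{12}=s\times\mathrm{id}$, $s_{23}=\mathrm{id}\times s$, $s_{13}=(\tau\times\mathrm{id})(\mathrm{id}\times s)(\tau\times\mathrm{id})$ and $\tau(x,y)=(y,x)$. It is finite if $S$ is finite, and bijective if $s$ is bijective. Write $s(x,y)=(x\cdot y,\theta_x(y))$ and $s^{-1}(x,y)=(\psi_y(x),y\circ x)$. Then $(S,\cdot)$ and $(S,\circ)$ are semigroups; $E(S,\cdot)$, $E(S,\circ)$ denote their sets of idempotents. For a finite bijective solution both are left groups (isomorphic to $E\times H$ with $H$ a group and $(e,g)(f,h)=(e,gh)$). Retract: fix $e_0\in E(S,\cdot)$, put $1=\theta_{e_0}(e_0)$,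 an idempotent of $(S,\cdot)$, and $G_1=1\cdot S$. Every element of $S$ is uniquely $e\cdot g$ with $e\in E(S,\cdot)$, $g\in G_1$. Define $e\cdot g\approx f\cdot h$ (for $e,f\in E(S,\cdot)$, $g,h\in G_1$) iff $\theta_e=\theta_f$ and $g=h$. The retract is $\overline{S}=S/\approx$ with the map $\overline{s}$ induced by $s$; it is a finite bijective solution, and it is irretractable (meaning that its own relation $\approx$ is equality). Decomposition of a finite irretractable bijective solution $(T,t)$, $t(x,y)=(x\cdot y,\theta_x(y))$, $t^{-1}(x,y)=(\psi_y(x),y\circ x)$, with distinguished element $1=\theta_{e_0}(e_0)$ for a fixed $e_0\in E(T,\cdot)$: $G=1\cdot T=E(T,\circ)$ is a group under $\cdot$, $A=1\circ T=E(T,\cdot)$ is a group under $\circ$, both with identity $1$, and $T$ is identified with $A\times G$ via $(a,x)=a\cdot x$. Put $\sigma_a(x)=1\cdot\theta_a(x)$ and $\delta_x(a)=(1\circ\psi_{x^{-1}}(a^{-1}))^{-1}$ for $a\in A$, $x\in G$ (inverses in $(G,\cdot)$ and $(A,\circ)$ respectively). Then $(A,G,\sigma,\delta)$ is a matched pair of groups and $\theta_{(a,x)}(b,y)=(b(\delta_x(a))^{-1},\sigma_{\delta_x(a)}(y))$, the product and inverse in the first component being those of $(A,\circ)$. Extension: for a finite irretractable bijective solution $(T,t)$ with $T$ identified with $A\times G$ via $(a,x)=a\cdot x$, where $A=1\circ T=E(T,\cdot)$ (a group under $\circ$), $G=1\cdot T=E(T,\circ)$ (a group under $\cdot$) and $\delta_x(a)=(1\circ\psi_{x^{-1}}(a^{-1}))^{-1}$,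 a set $X$ and permutations $\varphi_a\in\mathrm{Sym}(X)$ ($a\in A$), $\mathrm{Ext}_X^{\varphi}(T,t)$ is the solution on $X\times T=X\times A\times G$ given by $$((\alpha,a,x),(\beta,b,y))\mapsto\big((\alpha,a,xy),\ (\varphi^{-1}_{b(\delta_x(a))^{-1}}\varphi_b(\beta),\ \theta_{(a,x)}(b,y))\big).$$ *)

theory Defs
  imports "HOL-Algebra.Group"
begin

section \<open>Set-theoretic solutions to the Pentagon Equation\<close>

text \<open>A solution is given by a carrier set \<open>S\<close> and a map \<open>s\<close> on pairs; only the values of \<open>s\<close> on
  \<open>S \<times> S\<close> matter. Triples are nested to the right, so that \<open>s\<^sub>2\<^sub>3 = id \<times> s\<close> is
  literally \<open>map_prod id s\<close>.\<close>

definition leg12 :: "('a \<times> 'a \<Rightarrow> 'a \<times> 'a) \<Rightarrow> 'a \<times> 'a \<times> 'a \<Rightarrow> 'a \<times> 'a \<times> 'a" where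
  "leg12 s = (\<lambda>(x, y, z). case s (x, y) of (u, v) \<Rightarrow> (u, v, z))"

definition leg23 :: "('a \<times> 'a \<Rightarrow> 'a \<times> 'a) \<Rightarrow> 'a \<times> 'a \<times> 'a \<Rightarrow> 'a \<times> 'a \<times> 'a" where
  "leg23 s = map_prod id s"

definition leg13 :: "('a \<times> 'a \<Rightarrow> 'a \<times> 'a) \<Rightarrow> 'a \<times> 'a \<times> 'a \<Rightarrow> 'a \<times> 'a \<times> 'a" where
  "leg13 s = leg12 prod.swap \<circ> leg23 s \<circ> leg12 prod.swap"

definition pentagon_solution :: "'a set \<Rightarrow> ('a \<times> 'a \<Rightarrow> 'a \<times> 'a) \<Rightarrow> bool" where
  "pentagon_solution S s \<longleftrightarrow>
     S \<noteq> {} \<and> s \<in> S \<times> S \<rightarrow> S \<times> S \<and>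
     (\<forall>p \<in> S \<times> S \<times> S. (leg23 s \<circ> leg13 s \<circ> leg12 s) p = (leg12 s \<circ> leg23 s) p)"

definition finite_bijective_solution :: "'a set \<Rightarrow> ('a \<times> 'a \<Rightarrow> 'a \<times> 'a) \<Rightarrow> bool" where
  "finite_bijective_solution S s \<longleftrightarrow>
     pentagon_solution S s \<and> finite S \<and> bij_betw s (S \<times> S) (S \<times> S)"

text \<open>\<open>s (x, y) = (dot s x y, theta s x y)\<close>, written \<open>(x \<cdot> y, \<theta>\<^sub>x(y))\<close>.\<close>

definition dot :: "('a \<times> 'a \<Rightarrow> 'a \<times> 'a) \<Rightarrow> 'a \<Rightarrow> 'a \<Rightarrow> 'a" where
  "dot s x y = fst (s (x, y))"

definition theta :: "('a \<times> 'a \<Rightarrow> 'a \<times> 'a) \<Rightarrow> 'a \<Rightarrow> 'a \<Rightarrow> 'a" where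
  "theta s x y = snd (s (x, y))"

text \<open>\<open>s\<^sup>-\<^sup>1 (x, y) = (psi S s y x, circ S s y x)\<close>, written \<open>(\<psi>\<^sub>y(x), y \<circ> x)\<close>: note the order of
  the arguments.\<close>

definition psi :: "'a set \<Rightarrow> ('a \<times> 'a \<Rightarrow> 'a \<times> 'a) \<Rightarrow> 'a \<Rightarrow> 'a \<Rightarrow> 'a" where
  "psi S s y x = fst (inv_into (S \<times> S) s (x, y))"

definition circ :: "'a set \<Rightarrow> ('a \<times> 'a \<Rightarrow> 'a \<times> 'a) \<Rightarrow> 'a \<Rightarrow> 'a \<Rightarrow> 'a" where
  "circ S s y x = snd (inv_into (S \<times> S) s (x, y))"

definition idempotents :: "'a set \<Rightarrow> ('a \<Rightarrow> 'a \<Rightarrow> 'a) \<Rightarrow> 'a set" where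
  "idempotents S f = {e \<in> S. f e e = e}"

definition ker_theta :: "'a set \<Rightarrow> ('a \<times> 'a \<Rightarrow> 'a \<times> 'a) \<Rightarrow> 'a set" where
  "ker_theta S s = {x \<in> S. \<forall>y \<in> S. theta s x y = y}"

text \<open>The distinguished element \<open>1 = \<theta>\<^bsub>e\<^esub>(e)\<close> attached to an idempotent \<open>e\<close>, and \<open>1 \<cdot> S\<close>.\<close>

definition unit_elt :: "('a \<times> 'a \<Rightarrow> 'a \<times> 'a) \<Rightarrow> 'a \<Rightarrow> 'a" where
  "unit_elt s e = theta s e e"

definition G_set :: "'a set \<Rightarrow> ('a \<times> 'a \<Rightarrow> 'a \<times> 'a) \<Rightarrow> 'a \<Rightarrow> 'a set" where
  "G_set S s e = dot s (unit_elt s e) ` S"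


section \<open>The retract\<close>

text \<open>\<open>e \<cdot> g \<approx> f \<cdot> h\<close> iff \<open>\<theta>\<^bsub>e\<^esub> = \<theta>\<^bsub>f\<^esub>\<close> and \<open>g = h\<close>, relative to the choice of \<open>e0\<close>.\<close>

definition retract_rel :: "'a set \<Rightarrow> ('a \<times> 'a \<Rightarrow> 'a \<times> 'a) \<Rightarrow> 'a \<Rightarrow> ('a \<times> 'a) set" where
  "retract_rel S s e0 =
     {(dot s e g, dot s f h) | e f g h.
        e \<in> idempotents S (dot s) \<and> f \<in> idempotents S (dot s) \<and>
        g \<in> G_set S s e0 \<and> h \<in> G_set S s e0 \<and>
        (\<forall>z \<in> S. theta s e z = theta s f z) \<and> g = h}"

definition retract :: "'a set \<Rightarrow> ('a \<times> 'a \<Rightarrow> 'a \<times> 'a) \<Rightarrow> 'a \<Rightarrow> 'a set set" where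
  "retract S s e0 = S // retract_rel S s e0"

text \<open>The induced map on classes, lifted componentwise in the usual way for quotients: all
  representatives yield the same class, so that each union is that class.\<close>

definition retract_map ::
    "'a set \<Rightarrow> ('a \<times> 'a \<Rightarrow> 'a \<times> 'a) \<Rightarrow> 'a \<Rightarrow> 'a set \<times> 'a set \<Rightarrow> 'a set \<times> 'a set" where
  "retract_map S s e0 = (\<lambda>(U, V).
     (\<Union>u \<in> U. \<Union>v \<in> V. retract_rel S s e0 `` {dot s u v},
      \<Union>u \<in> U. \<Union>v \<in> V. retract_rel S s e0 `` {theta s u v}))"


section \<open>Decomposition of an irretractable solution\<close>

text \<open>The groups \<open>A = 1 \<circ> T\<close> under \<open>\<circ>\<close> and \<open>G = 1 \<cdot> T\<close> under \<open>\<cdot>\<close>.\<close>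

definition A_group :: "'a set \<Rightarrow> ('a \<times> 'a \<Rightarrow> 'a \<times> 'a) \<Rightarrow> 'a \<Rightarrow> 'a monoid" where
  "A_group T t e =
     \<lparr>carrier = circ T t (unit_elt t e) ` T, monoid.mult = circ T t, one = unit_elt t e\<rparr>"

definition G_group :: "'a set \<Rightarrow> ('a \<times> 'a \<Rightarrow> 'a \<times> 'a) \<Rightarrow> 'a \<Rightarrow> 'a monoid" where
  "G_group T t e =
     \<lparr>carrier = G_set T t e, monoid.mult = dot t, one = unit_elt t e\<rparr>"

text \<open>The identification of \<open>T\<close> with \<open>A \<times> G\<close>: \<open>components T t e u\<close> is the pair
  \<open>(a, x)\<close> with \<open>u = a \<cdot> x\<close>.\<close>

definition components :: "'a set \<Rightarrow> ('a \<times> 'a \<Rightarrow> 'a \<times> 'a) \<Rightarrow> 'a \<Rightarrow> 'a \<Rightarrow> 'a \<times> 'a" where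
  "components T t e u =
     (THE p. p \<in> carrier (A_group T t e) \<times> carrier (G_group T t e) \<and> u = dot t (fst p) (snd p))"

text \<open>\<open>\<delta>\<^sub>x(a) = (1 \<circ> \<psi>\<^bsub>x\<^sup>-\<^sup>1\<^esub>(a\<^sup>-\<^sup>1))\<^sup>-\<^sup>1\<close>\<close>

definition delta ::
    "'a set \<Rightarrow> ('a \<times> 'a \<Rightarrow> 'a \<times> 'a) \<Rightarrow> 'a \<Rightarrow> 'a \<Rightarrow> 'a \<Rightarrow> 'a" where
  "delta T t e x a =
     m_inv (A_group T t e)
       (circ T t (unit_elt t e) (psi T t (m_inv (G_group T t e) x) (m_inv (A_group T t e) a)))"


section \<open>Extensions\<close>

text \<open>The map of \<open>Ext\<^sub>X\<^sup>\<phi>(T, t)\<close> on the carrier \<open>X \<times> T\<close>, where \<open>T = A \<times> G\<close> by means of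
  \<open>components\<close>: for \<open>u = (a, x)\<close> and \<open>v = (b, y)\<close>, the pair \<open>((\<alpha>, u), (\<beta>, v))\<close> is sent to
  \<open>((\<alpha>, a, x y), (\<phi>\<^sub>c\<^sup>-\<^sup>1 (\<phi>\<^sub>b \<beta>), \<theta>\<^sub>u(v)))\<close> with \<open>c = b \<circ> \<delta>\<^sub>x(a)\<^sup>-\<^sup>1\<close> computed in \<open>(A, \<circ>)\<close>.\<close>

definition ext_map ::
    "'b set \<Rightarrow> ('a \<Rightarrow> 'b \<Rightarrow> 'b) \<Rightarrow> 'a set \<Rightarrow> ('a \<times> 'a \<Rightarrow> 'a \<times> 'a) \<Rightarrow> 'a
      \<Rightarrow> ('b \<times> 'a) \<times> ('b \<times> 'a) \<Rightarrow> ('b \<times> 'a) \<times> ('b \<times> 'a)" where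
  "ext_map X \<phi> T t e = (\<lambda>((\<alpha>, u), (\<beta>, v)).
     let (a, x) = components T t e u;
         (b, y) = components T t e v;
         c = b \<otimes>\<^bsub>A_group T t e\<^esub> m_inv (A_group T t e) (delta T t e x a)
     in ((\<alpha>, dot t a (x \<otimes>\<^bsub>G_group T t e\<^esub> y)),
         (inv_into X (\<phi> c) (\<phi> b \<beta>), theta t u v)))"

text \<open>\<open>(S, s)\<close> equals \<open>(S', s')\<close> up to identifying \<open>S\<close> with \<open>S'\<close> along the bijection \<open>F\<close>.\<close>

definition identifies ::
    "('a \<Rightarrow> 'b) \<Rightarrow> 'a set \<Rightarrow> ('a \<times> 'a \<Rightarrow> 'a \<times> 'a) \<Rightarrow> 'b set \<Rightarrow> ('b \<times> 'b \<Rightarrow> 'b \<times> 'b) \<Rightarrow> bool" where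
  "identifies F S s S' s' \<longleftrightarrow>
     bij_betw F S S' \<and> (\<forall>x \<in> S. \<forall>y \<in> S. s' (F x, F y) = map_prod F F (s (x, y)))"

end

theory Submission
  imports Defs
begin

text \<open>Write \<open>e\<close> for the idempotent part of an element \<open>y = e \<cdot> g\<close>. All maps \<open>\<theta>\<^sub>x\<close> permute \<open>S\<close> and
  \<open>E(S, \<cdot>)\<close>, they are closed under inverses, and \<open>\<theta>\<^bsub>\<theta>\<^sub>x(e)\<^esub> \<theta>\<^sub>x = \<theta>\<^sub>e\<close> for idempotents \<open>e\<close>. Hence every
  orbit of these permutations on \<open>E(S, \<cdot>)\<close> meets each fibre of \<open>e \<mapsto> \<theta>\<^sub>e\<close> exactly once; it meets
  \<open>ker \<theta>\<close> in \<open>\<theta>\<^sub>e(e)\<close>. So \<open>y \<mapsto> (\<theta>\<^sub>e(e), [y])\<close> identifies \<open>S\<close> with \<open>X \<times> S/\<approx>\<close>, and since the first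
  component is constant on orbits, all the permutations \<open>\<phi>\<^sub>a\<close> can be taken to be the identity.\<close>

section \<open>Componentwise form of the axioms\<close>

lemma pentagon_solution_iff:
  "pentagon_solution S s \<longleftrightarrow>
     S \<noteq> {} \<and> (\<forall>x\<in>S. \<forall>y\<in>S. dot s x y \<in> S \<and> theta s x y \<in> S) \<and>
     (\<forall>x\<in>S. \<forall>y\<in>S. \<forall>z\<in>S.
        dot s (dot s x y) z = dot s x (dot s y z) \<and>
        dot s (theta s x y) (theta s (dot s x y) z) = theta s x (dot s y z) \<and>
        theta s (theta s x y) (theta s (dot s x y) z) = theta s y z)"
proof -
  have s: "s (x, y) = (dot s x y, theta s x y)" for x y
    by (simp add: dot_def theta_def)
  have "s \<in> S \<times> S \<rightarrow> S \<times> S \<longleftrightarrow> (\<forall>x\<in>S. \<forall>y\<in>S. dot s x y \<in> S \<and> theta s x y \<in> S)"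
    by (auto simp: Pi_iff s)
  then show ?thesis
    by (simp add: pentagon_solution_def leg12_def leg13_def leg23_def s)
qed

text \<open>On a finite set surjectivity already gives bijectivity, and surjectivity passes easily
  to a quotient.\<close>

lemma finite_bijective_solution_iff:
  "finite_bijective_solution S s \<longleftrightarrow>
     pentagon_solution S s \<and> finite S \<and>
     (\<forall>u\<in>S. \<forall>v\<in>S. \<exists>x\<in>S. \<exists>y\<in>S. dot s x y = u \<and> theta s x y = v)"
proof -
  have s: "s (x, y) = (dot s x y, theta s x y)" for x y
    by (simp add: dot_def theta_def)
  have "bij_betw s (S \<times> S) (S \<times> S) \<longleftrightarrow>
      (\<forall>u\<in>S. \<forall>v\<in>S. \<exists>x\<in>S. \<exists>y\<in>S. dot s x y = u \<and> theta s x y = v)"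
    if P: "pentagon_solution S s" and fin: "finite S"
  proof -
    have "s ` (S \<times> S) \<subseteq> S \<times> S"
      using P unfolding pentagon_solution_def by blast
    moreover have "S \<times> S \<subseteq> s ` (S \<times> S) \<longleftrightarrow>
        (\<forall>u\<in>S. \<forall>v\<in>S. \<exists>x\<in>S. \<exists>y\<in>S. dot s x y = u \<and> theta s x y = v)"
      by (force simp: s image_iff)
    moreover have "inj_on s (S \<times> S)" if "s ` (S \<times> S) = S \<times> S"
      using that fin by (simp add: eq_card_imp_inj_on)
    ultimately show ?thesis
      unfolding bij_betw_def by blast
  qed
  then show ?thesis
    unfolding finite_bijective_solution_def by blast
qed

section \<open>Finite bijective solutions are left groups\<close>

locale pentagon =
  fixes S :: "'a set" and s :: "'a \<times> 'a \<Rightarrow> 'a \<times> 'a"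
  assumes solution: "finite_bijective_solution S s"
begin

abbreviation dot' (infixl "\<cdot>" 70) where "x \<cdot> y \<equiv> dot s x y"
abbreviation "\<theta> \<equiv> theta s"
abbreviation "E \<equiv> idempotents S (dot s)"

lemma s_eq: "s (x, y) = (x \<cdot> y, \<theta> x y)"
  by (simp add: dot_def theta_def)

lemma pentagon: "pentagon_solution S s"
  and finite_S [simp]: "finite S"
  and bij_s: "bij_betw s (S \<times> S) (S \<times> S)"
  using solution by (auto simp: finite_bijective_solution_def)

lemma nonempty: "S \<noteq> {}"
  and dot_closed [simp]: "\<lbrakk>x \<in> S; y \<in> S\<rbrakk> \<Longrightarrow> x \<cdot> y \<in> S"
  and theta_closed [simp]: "\<lbrakk>x \<in> S; y \<in> S\<rbrakk> \<Longrightarrow> \<theta> x y \<in> S"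
  and assoc: "\<lbrakk>x \<in> S; y \<in> S; z \<in> S\<rbrakk> \<Longrightarrow> x \<cdot> y \<cdot> z = x \<cdot> (y \<cdot> z)"
  and theta_dot: "\<lbrakk>x \<in> S; y \<in> S; z \<in> S\<rbrakk> \<Longrightarrow> \<theta> x (y \<cdot> z) = \<theta> x y \<cdot> \<theta> (x \<cdot> y) z"
  and theta_theta: "\<lbrakk>x \<in> S; y \<in> S; z \<in> S\<rbrakk> \<Longrightarrow> \<theta> (\<theta> x y) (\<theta> (x \<cdot> y) z) = \<theta> y z"
  using pentagon unfolding pentagon_solution_iff by auto

lemma s_inject:
  assumes "x \<in> S" "y \<in> S" "x' \<in> S" "y' \<in> S" "x \<cdot> y = x' \<cdot> y'" "\<theta> x y = \<theta> x' y'"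
  shows "x = x' \<and> y = y'"
proof -
  have "s (x, y) = s (x', y')"
    using assms by (simp add: s_eq)
  then show ?thesis
    using inj_onD[OF bij_betw_imp_inj_on[OF bij_s], of "(x, y)" "(x', y')"] assms by auto
qed

lemma s_surject:
  assumes "u \<in> S" "v \<in> S"
  obtains x y where "x \<in> S" "y \<in> S" "x \<cdot> y = u" "\<theta> x y = v"
  using solution assms unfolding finite_bijective_solution_iff by blast

text \<open>The complement of a one-sided ideal is an ideal of the same kind: \<open>s\<close> maps \<open>R \<times> S\<close> into
  itself for right ideals \<open>R\<close>, and \<open>S \<times> L\<close> into \<open>L \<times> S\<close> for left ideals \<open>L\<close>, hence onto by
  counting.\<close>

lemma right_ideal_complement:
  assumes "R \<subseteq> S" "\<And>x y. \<lbrakk>x \<in> R; y \<in> S\<rbrakk> \<Longrightarrow> x \<cdot> y \<in> R"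
    and "x \<in> S" "y \<in> S" "x \<cdot> y \<in> R"
  shows "x \<in> R"
proof -
  have "inj_on s (R \<times> S)"
    by (rule inj_on_subset[OF bij_betw_imp_inj_on[OF bij_s]]) (use assms(1) in auto)
  moreover have "s ` (R \<times> S) \<subseteq> R \<times> S"
    using assms(1,2) by (auto simp: s_eq)
  moreover have "finite (R \<times> S)"
    using finite_subset[OF assms(1)] by simp
  ultimately have "s ` (R \<times> S) = R \<times> S"
    by (simp add: endo_inj_surj)
  moreover have "(x \<cdot> y, \<theta> x y) \<in> R \<times> S"
    using assms by simp
  ultimately have "(x \<cdot> y, \<theta> x y) \<in> s ` (R \<times> S)"
    by simp
  then obtain x' y' where "x' \<in> R" "y' \<in> S" "(x \<cdot> y, \<theta> x y) = s (x', y')"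
    by blast
  then show ?thesis
    using s_inject[of x y x' y'] assms by (auto simp: s_eq)
qed

lemma left_ideal_complement:
  assumes "L \<subseteq> S" "\<And>x y. \<lbrakk>x \<in> S; y \<in> L\<rbrakk> \<Longrightarrow> x \<cdot> y \<in> L"
    and "x \<in> S" "y \<in> S" "x \<cdot> y \<in> L"
  shows "y \<in> L"
proof -
  have "inj_on s (S \<times> L)"
    by (rule inj_on_subset[OF bij_betw_imp_inj_on[OF bij_s]]) (use assms(1) in auto)
  then have card: "card (s ` (S \<times> L)) = card (L \<times> S)"
    by (simp add: card_image card_cartesian_product)
  have "s ` (S \<times> L) \<subseteq> L \<times> S"
    using assms(1,2) by (auto simp: s_eq)
  moreover have "finite (L \<times> S)"
    using finite_subset[OF assms(1)] by simp
  ultimately have "s ` (S \<times> L) = L \<times> S"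
    by (rule card_subset_eq[OF _ _ card, rotated])
  moreover have "(x \<cdot> y, \<theta> x y) \<in> L \<times> S"
    using assms by simp
  ultimately have "(x \<cdot> y, \<theta> x y) \<in> s ` (S \<times> L)"
    by simp
  then obtain x' y' where "x' \<in> S" "y' \<in> L" "(x \<cdot> y, \<theta> x y) = s (x', y')"
    by blast
  then show ?thesis
    using s_inject[of x y x' y'] assms by (auto simp: s_eq)
qed

text \<open>The product \<open>u \<cdot> (t \<cdot> t)\<close> lies in the right ideal
  \<open>(u \<cdot> t) \<cdot> S\<close>, hence so does \<open>u\<close>.\<close>

lemma right_regular:
  assumes "u \<in> S" "t \<in> S"
  obtains r where "r \<in> S" "u = u \<cdot> t \<cdot> r"
proof -
  have "u \<in> dot s (u \<cdot> t) ` S"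
    by (rule right_ideal_complement[where y = "t \<cdot> t"]) (use assms in \<open>auto simp: assoc\<close>)
  then show ?thesis
    using that by blast
qed

lemma left_regular:
  assumes "w \<in> S" "t \<in> S"
  obtains r where "r \<in> S" "w = r \<cdot> (t \<cdot> w)"
proof -
  have "w \<in> (\<lambda>r. r \<cdot> (t \<cdot> w)) ` S"
  proof (rule left_ideal_complement[where x = "t \<cdot> t"])
    show "x \<cdot> y \<in> (\<lambda>r. r \<cdot> (t \<cdot> w)) ` S" if x: "x \<in> S" and y: "y \<in> (\<lambda>r. r \<cdot> (t \<cdot> w)) ` S" for x y
    proof -
      obtain r where "r \<in> S" "y = r \<cdot> (t \<cdot> w)"
        using y by blast
      then have "x \<cdot> y = x \<cdot> r \<cdot> (t \<cdot> w)" "x \<cdot> r \<in> S"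
        using x assms by (simp_all add: assoc)
      then show ?thesis
        by blast
    qed
  qed (use assms in \<open>auto simp: assoc\<close>)
  then show ?thesis
    using that by blast
qed

text \<open>If \<open>u \<cdot> z = u\<close> and \<open>x \<cdot> w = u\<close> then \<open>w \<cdot> z = w\<close>, so that \<open>\<theta>\<^sub>x(w) = \<theta>\<^sub>x(w) \<cdot> \<theta>\<^sub>u(z)\<close>: the left
  ideal of the second component of \<open>s (x, w)\<close> is determined by the first component. By
  surjectivity of \<open>s\<close> there is only one left ideal.\<close>

lemma left_ideal_generator: "\<exists>c\<in>S. \<forall>v\<in>S. \<exists>y\<in>S. v = y \<cdot> c"
proof -
  obtain u where u: "u \<in> S"
    using nonempty by blast
  obtain r where r: "r \<in> S" "u = u \<cdot> u \<cdot> r"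
    using right_regular u by metis
  define z where "z = u \<cdot> r"
  have z: "z \<in> S" "u \<cdot> z = u"
    using u r by (simp_all add: z_def assoc)
  have "\<exists>y\<in>S. v = y \<cdot> \<theta> u z" if v: "v \<in> S" for v
  proof -
    obtain x w where xw: "x \<in> S" "w \<in> S" "x \<cdot> w = u" "\<theta> x w = v"
      using s_surject u v by metis
    obtain q where q: "q \<in> S" "w = q \<cdot> (x \<cdot> w)"
      using left_regular xw by metis
    have "w \<cdot> z = w"
      using q xw z by (metis assoc u)
    then have "v = v \<cdot> \<theta> u z"
      using theta_dot[of x w z] xw z by simp
    then show ?thesis
      using v by blast
  qed
  then show ?thesis
    using u z by (metis theta_closed)
qed

text \<open>The generator \<open>c\<close> yields a right identity \<open>e\<close> of all of
  \<open>S\<close>. As \<open>e = e \<cdot> d \<cdot> t\<close> for some \<open>t\<close>, right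
  multiplication by \<open>t\<close> undoes that by \<open>d\<close>.\<close>

lemma right_cancel:
  assumes "x \<in> S" "y \<in> S" "d \<in> S" "x \<cdot> d = y \<cdot> d"
  shows "x = y"
proof -
  obtain c where c: "c \<in> S" "\<forall>v\<in>S. \<exists>y\<in>S. v = y \<cdot> c"
    using left_ideal_generator by blast
  obtain r where r: "r \<in> S" "c = c \<cdot> c \<cdot> r"
    using right_regular c by metis
  define e where "e = c \<cdot> r"
  have e: "e \<in> S" "v \<cdot> e = v" if "v \<in> S" for v
    using c r that by (auto simp: e_def) (metis assoc dot_closed)
  have eS: "e \<in> S"
    using e(1) assms(1) .
  obtain t where t: "t \<in> S" "e = e \<cdot> d \<cdot> t"
    using right_regular eS assms(3) by metis
  have "v \<cdot> d \<cdot> t = v" if "v \<in> S" for v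
    using e eS t that assms(3) by (metis assoc dot_closed)
  then show ?thesis
    using assms by metis
qed

lemma left_simple:
  assumes "x \<in> S" "d \<in> S"
  obtains y where "y \<in> S" "y \<cdot> d = x"
proof -
  have "inj_on (\<lambda>y. y \<cdot> d) S"
    by (rule inj_onI) (rule right_cancel[OF _ _ assms(2)])
  moreover have "(\<lambda>y. y \<cdot> d) ` S \<subseteq> S"
    using assms by auto
  ultimately have "(\<lambda>y. y \<cdot> d) ` S = S"
    by (rule endo_inj_surj[OF finite_S, rotated])
  then have "x \<in> (\<lambda>y. y \<cdot> d) ` S"
    using assms(1) by simp
  then show ?thesis
    using that by blast
qed

section \<open>Idempotents and idempotent parts\<close>

lemma E_carrier [simp]: "e \<in> E \<Longrightarrow> e \<in> S"
  and E_idem: "e \<in> E \<Longrightarrow> e \<cdot> e = e"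
  and E_I: "\<lbrakk>e \<in> S; e \<cdot> e = e\<rbrakk> \<Longrightarrow> e \<in> E"
  by (simp_all add: idempotents_def)

lemma dot_idempotent [simp]:
  assumes "e \<in> E" "x \<in> S"
  shows "x \<cdot> e = x"
proof (rule right_cancel)
  show "x \<cdot> e \<cdot> e = x \<cdot> e"
    using assms by (simp add: assoc E_idem)
qed (use assms in simp_all)

text \<open>The first coordinate of \<open>x\<close> in the left group \<open>E \<times> H\<close>;
  right cancellation makes it unique.\<close>

definition ep :: "'a \<Rightarrow> 'a" where
  "ep x = (THE e. e \<in> E \<and> e \<cdot> x = x)"

lemma ep_eqI:
  assumes "e \<in> E" "x \<in> S" "e \<cdot> x = x"
  shows "ep x = e"
  unfolding ep_def
proof (rule the_equality)
  show "e' = e" if "e' \<in> E \<and> e' \<cdot> x = x" for e'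
    by (rule right_cancel[of _ _ x]) (use that assms in simp_all)
qed (use assms in simp)

lemma
  assumes "x \<in> S"
  shows ep_E [simp]: "ep x \<in> E" and ep_dot [simp]: "ep x \<cdot> x = x"
proof -
  obtain e where e: "e \<in> S" "e \<cdot> x = x"
    by (rule left_simple[OF assms assms])
  have "e \<cdot> e = e"
    by (rule right_cancel[of _ _ x]) (simp_all add: assoc e assms)
  with e(1) have "e \<in> E"
    by (rule E_I)
  moreover have "ep x = e"
    using \<open>e \<in> E\<close> assms e(2) by (rule ep_eqI)
  ultimately show "ep x \<in> E" "ep x \<cdot> x = x"
    using e(2) by simp_all
qed

lemma ep_dot_eq [simp]: "\<lbrakk>x \<in> S; y \<in> S\<rbrakk> \<Longrightarrow> ep (x \<cdot> y) = ep x"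
  by (rule ep_eqI) (simp_all flip: assoc)

lemma ep_idempotent [simp]: "e \<in> E \<Longrightarrow> ep e = e"
  by (rule ep_eqI) (simp_all)

lemma ep_decomp: "\<lbrakk>e \<in> E; x \<in> S\<rbrakk> \<Longrightarrow> ep x \<cdot> (e \<cdot> x) = x"
  by (simp flip: assoc)

lemma theta_E [simp]:
  assumes "x \<in> S" "e \<in> E"
  shows "\<theta> x e \<in> E"
proof (rule E_I)
  show "\<theta> x e \<cdot> \<theta> x e = \<theta> x e"
    using theta_dot[of x e e, symmetric] assms by (simp add: E_idem)
qed (use assms in simp)

lemma ep_theta [simp]:
  assumes "x \<in> S" "y \<in> S"
  shows "ep (\<theta> x y) = \<theta> x (ep y)"
proof -
  have "\<theta> x (ep y) \<cdot> \<theta> x y = \<theta> x y"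
    using theta_dot[of x "ep y" y, symmetric] assms by simp
  then show ?thesis
    using assms by (intro ep_eqI) simp_all
qed

lemma theta_inj_E:
  assumes "x \<in> S" "e \<in> E" "e' \<in> E" "\<theta> x e = \<theta> x e'"
  shows "e = e'"
  using s_inject[of x e x e'] assms by (metis E_carrier dot_idempotent)

end

section \<open>The permutations \<open>\<theta>\<^sub>x\<close>\<close>

locale pentagon_pointed = pentagon +
  fixes e0
  assumes e0: "e0 \<in> E"
begin

text \<open>The distinguished element \<open>unit_elt s e0\<close>, usually written 1.\<close>

definition f where "f = \<theta> e0 e0"

lemma f_E [simp]: "f \<in> E"
  using e0 by (simp add: f_def)

lemma f_S [simp]: "f \<in> S"
  by (rule E_carrier) simp

lemma G_set_eq: "G_set S s e0 = dot s f ` S"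
  by (simp add: G_set_def unit_elt_def f_def)

text \<open>As \<open>\<theta> f f = f\<close>, the map \<open>\<theta> f\<close> is idempotent, so
  it fixes its image. It is injective on \<open>E\<close>, and its image contains
  \<open>f \<cdot> S\<close>; every \<open>z\<close> is a product of elements of these two
  sets.\<close>

lemma theta_f [simp]:
  assumes z: "z \<in> S"
  shows "\<theta> f z = z"
proof -
  have ff: "\<theta> f f = f"
    using theta_theta[of e0 e0 e0] e0 by (simp add: f_def)
  have idem: "\<theta> f (\<theta> f x) = \<theta> f x" if "x \<in> S" for x
    using theta_theta[of f f x] that by (simp add: ff)
  have fE: "\<theta> f e = e" if "e \<in> E" for e
    by (rule theta_inj_E[of f]) (use idem that in simp_all)
  have fG: "\<theta> f g = g" if g: "g \<in> S" "f \<cdot> g = g" for g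
  proof -
    \<comment> \<open>With \<open>f = g \<cdot> v\<close> and a preimage \<open>(x, y)\<close> of
      \<open>(f, v)\<close> under \<open>s\<close>, expanding
      \<open>\<theta> f (x \<cdot> y) = f\<close> gives
      \<open>\<theta> f x \<cdot> v = g \<cdot> v\<close>.\<close>
    obtain v where v: "v \<in> S" "f = f \<cdot> g \<cdot> v"
      using right_regular[of f g] g by auto
    obtain x y where xy: "x \<in> S" "y \<in> S" "x \<cdot> y = f" "\<theta> x y = v"
      using s_surject[of f v] v by auto
    have "x \<in> dot s f ` S"
    proof (rule right_ideal_complement[where y = y])
      show "x \<cdot> y \<in> dot s f ` S"
        using xy by (metis dot_idempotent f_E f_S image_eqI)
    qed (use xy in \<open>auto simp: assoc\<close>)
    then have "f \<cdot> x = x"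
      by (auto simp flip: assoc)
    then have "\<theta> f x \<cdot> v = g \<cdot> v"
      using theta_dot[of f x y] xy v g ff by simp
    from right_cancel[OF _ g(1) v(1) this] have "\<theta> f x = g"
      using xy(1) by simp
    then show ?thesis
      using idem xy by auto
  qed
  have "f \<cdot> (f \<cdot> z) = f \<cdot> z"
    using z by (simp flip: assoc)
  then have "\<theta> f (ep z \<cdot> (f \<cdot> z)) = ep z \<cdot> (f \<cdot> z)"
    using z theta_dot[of f "ep z" "f \<cdot> z"] by (simp add: fE fG)
  then show ?thesis
    using z by (simp add: ep_decomp)
qed

text \<open>This also shows that the inverse of \<open>\<theta>\<^sub>x\<close> is again one of the maps \<open>\<theta>\<^sub>y\<close>.\<close>

lemma theta_left_inverse:
  assumes "x \<in> S" "z \<in> S"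
  shows "\<theta> (\<theta> x f) (\<theta> x z) = z"
  using theta_theta[of x f z] assms by simp

lemma theta_inj:
  assumes "x \<in> S" "y \<in> S" "z \<in> S" "\<theta> x y = \<theta> x z"
  shows "y = z"
  using theta_left_inverse assms by metis

lemma theta_right_inverse:
  assumes "x \<in> S" "z \<in> S"
  shows "\<theta> x (\<theta> (\<theta> x f) z) = z"
  by (rule theta_inj[of "\<theta> x f"]) (use assms in \<open>simp_all add: theta_left_inverse\<close>)

lemma theta_surj:
  assumes "x \<in> S" "z \<in> S"
  obtains w where "w \<in> S" "\<theta> x w = z"
  using that[of "\<theta> (\<theta> x f) z"] theta_right_inverse assms by simp

text \<open>The pentagon identity at \<open>(f, y, z)\<close> makes \<open>\<theta> y\<close>
  idempotent, and it is injective.\<close>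

lemma theta_G [simp]:
  assumes y: "y \<in> S" "f \<cdot> y = y" and z: "z \<in> S"
  shows "\<theta> y z = z"
  by (rule theta_inj[of y]) (use theta_theta[of f y z] assms in simp_all)

lemma theta_theta_E:
  assumes "x \<in> S" "e \<in> E" "z \<in> S"
  shows "\<theta> (\<theta> x e) (\<theta> x z) = \<theta> e z"
  using theta_theta[of x e z] assms by simp

lemma theta_self_ker:
  assumes "e \<in> E" "z \<in> S"
  shows "\<theta> (\<theta> e e) z = z"
proof -
  obtain w where "w \<in> S" "\<theta> e w = z"
    by (rule theta_surj[OF E_carrier[OF assms(1)] assms(2)])
  then show ?thesis
    using theta_theta_E[of e e w] assms by simp
qed

section \<open>The retract\<close>

abbreviation "rel \<equiv> retract_rel S s e0"
abbreviation "T \<equiv> retract S s e0"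
abbreviation "t \<equiv> retract_map S s e0"

text \<open>An element \<open>e \<cdot> g\<close> with \<open>g\<close> in
  \<open>f \<cdot> S\<close> has idempotent part \<open>e\<close>, and \<open>f\<close> times it is
  \<open>g\<close>, so representatives can be replaced by coordinates.\<close>

lemma rel_iff:
  "(x, y) \<in> rel \<longleftrightarrow>
     x \<in> S \<and> y \<in> S \<and> f \<cdot> x = f \<cdot> y \<and> (\<forall>z\<in>S. \<theta> (ep x) z = \<theta> (ep y) z)"
  (is "?L \<longleftrightarrow> ?R")
proof
  assume ?L
  then obtain e e' g where *: "e \<in> E" "e' \<in> E" "g \<in> dot s f ` S"
    "\<forall>z\<in>S. \<theta> e z = \<theta> e' z" "x = e \<cdot> g" "y = e' \<cdot> g"
    by (auto simp: retract_rel_def G_set_eq)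
  then have "g \<in> S"
    by auto
  with * show ?R
    by (simp flip: assoc)
next
  assume R: ?R
  have "x = ep x \<cdot> (f \<cdot> x)" "y = ep y \<cdot> (f \<cdot> y)"
    using R ep_decomp[OF f_E] by metis+
  then have "(x, y) = (ep x \<cdot> (f \<cdot> x), ep y \<cdot> (f \<cdot> y))"
    by (rule arg_cong2)
  then show ?L
    unfolding retract_rel_def G_set_eq mem_Collect_eq
    \<comment> \<open>Unifying with the pair equation chooses all four witnesses.\<close>
    by (intro exI conjI) (assumption, use R in auto)
qed

lemma equiv_rel: "equiv S rel"
  by (rule equivI) (auto simp: refl_on_def sym_def trans_def rel_iff)

definition cl where "cl x = rel `` {x}"

lemma cl_eq_iff:
  assumes "x \<in> S" "y \<in> S"
  shows "cl x = cl y \<longleftrightarrow> (x, y) \<in> rel"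
  using eq_equiv_class_iff[OF equiv_rel assms] by (simp add: cl_def)

lemma T_eq: "T = cl ` S"
  by (auto simp: retract_def quotient_def cl_def)

lemma cl_T [simp]: "x \<in> S \<Longrightarrow> cl x \<in> T"
  by (simp add: T_eq)

lemma rel_dot:
  assumes "(x, x') \<in> rel" "(y, y') \<in> rel"
  shows "(x \<cdot> y, x' \<cdot> y') \<in> rel"
proof -
  have *: "f \<cdot> (x \<cdot> y) = f \<cdot> x \<cdot> (f \<cdot> y)" if "x \<in> S" "y \<in> S" for x y
    using that by (simp add: assoc[of f x] flip: assoc[of x f])
  show ?thesis
    using assms by (simp add: rel_iff *)
qed

text \<open>By \<open>theta_G\<close> at \<open>f \<cdot> x\<close>, this exhibits
  \<open>\<theta> x\<close> as the inverse of a permutation that depends only on the class of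
  \<open>x\<close>.\<close>

lemma theta_decomp:
  assumes "x \<in> S" "z \<in> S"
  shows "\<theta> (\<theta> (ep x) (f \<cdot> x)) (\<theta> x z) = z"
  using theta_theta[of "ep x" "f \<cdot> x" z] assms by (simp add: ep_decomp) (simp flip: assoc)

lemma rel_theta_left:
  assumes "(x, x') \<in> rel" "z \<in> S"
  shows "\<theta> x z = \<theta> x' z"
proof -
  have S: "x \<in> S" "x' \<in> S"
    using assms by (auto simp: rel_iff)
  have *: "\<theta> (ep x) (f \<cdot> x) = \<theta> (ep x') (f \<cdot> x')"
    using assms by (auto simp: rel_iff)
  show ?thesis
    by (rule theta_inj[of "\<theta> (ep x) (f \<cdot> x)"])
      (use theta_decomp[of x z] theta_decomp[of x' z] S assms(2) * in simp_all)
qed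

text \<open>In \<open>\<theta> x y = \<theta> x (ep y) \<cdot> \<theta> x (f \<cdot> y)\<close> the
  first factor is an idempotent, which \<open>f\<close> absorbs. The action of that idempotent is
  that of \<open>ep y\<close> after the inverse of \<open>\<theta> x\<close>.\<close>

lemma rel_theta_right:
  assumes "x \<in> S" "(y, y') \<in> rel"
  shows "(\<theta> x y, \<theta> x y') \<in> rel"
proof -
  have S: "y \<in> S" "y' \<in> S"
    using assms by (auto simp: rel_iff)
  have 1: "f \<cdot> \<theta> x y = f \<cdot> \<theta> x (f \<cdot> y)" if "y \<in> S" for y
    using theta_dot[of x "ep y" "f \<cdot> y"] that assms(1) by (simp add: ep_decomp flip: assoc)
  have "f \<cdot> \<theta> x y = f \<cdot> \<theta> x y'"
    using 1[of y] 1[of y'] assms by (simp add: rel_iff)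
  moreover have "\<theta> (\<theta> x (ep y)) z = \<theta> (\<theta> x (ep y')) z" if z: "z \<in> S" for z
  proof -
    obtain w where "w \<in> S" "\<theta> x w = z"
      by (rule theta_surj[OF assms(1) z])
    then show ?thesis
      using theta_theta_E[of x "ep y" w] theta_theta_E[of x "ep y'" w] assms by (auto simp: rel_iff)
  qed
  ultimately show ?thesis
    using assms(1) S by (simp add: rel_iff)
qed

lemma rel_theta:
  assumes "(x, x') \<in> rel" "(y, y') \<in> rel"
  shows "(\<theta> x y, \<theta> x' y') \<in> rel"
  using rel_theta_left[OF assms(1), of y'] rel_theta_right[of x y y'] assms by (auto simp: rel_iff)

lemma t_cl:
  assumes "x \<in> S" "y \<in> S"
  shows "t (cl x, cl y) = (cl (x \<cdot> y), cl (\<theta> x y))"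
proof -
  have mem: "x \<in> cl x" "y \<in> cl y"
    using assms by (simp_all add: cl_def rel_iff)
  have *: "(\<Union>u\<in>cl x. \<Union>v\<in>cl y. cl (op u v)) = cl (op x y)"
    if "\<And>u v. \<lbrakk>(x, u) \<in> rel; (y, v) \<in> rel\<rbrakk> \<Longrightarrow> (op x y, op u v) \<in> rel" for op
  proof -
    have "cl (op u v) = cl (op x y)" if "u \<in> cl x" "v \<in> cl y" for u v
      using \<open>\<And>u v. \<lbrakk>(x, u) \<in> rel; (y, v) \<in> rel\<rbrakk> \<Longrightarrow> (op x y, op u v) \<in> rel\<close>[of u v] that
      unfolding cl_def using equiv_class_eq[OF equiv_rel] by blast
    then show ?thesis
      using mem by blast
  qed
  show ?thesis
    using *[of "dot s"] *[of \<theta>] rel_dot rel_theta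
    by (simp add: retract_map_def cl_def)
qed

lemma dot_cl [simp]: "\<lbrakk>x \<in> S; y \<in> S\<rbrakk> \<Longrightarrow> dot t (cl x) (cl y) = cl (x \<cdot> y)"
  and theta_cl [simp]: "\<lbrakk>x \<in> S; y \<in> S\<rbrakk> \<Longrightarrow> theta t (cl x) (cl y) = cl (\<theta> x y)"
  by (simp_all add: dot_def[of t] theta_def[of t] t_cl)

lemma retract_solution: "finite_bijective_solution T t"
proof -
  have "\<exists>x\<in>S. \<exists>y\<in>S. dot t (cl x) (cl y) = cl u \<and> theta t (cl x) (cl y) = cl v"
    if uv: "u \<in> S" "v \<in> S" for u v
  proof -
    obtain x y where "x \<in> S" "y \<in> S" "x \<cdot> y = u" "\<theta> x y = v"
      by (rule s_surject[OF uv])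
    then show ?thesis
      using dot_cl theta_cl by blast
  qed
  then show ?thesis
    using nonempty
    by (simp add: finite_bijective_solution_iff pentagon_solution_iff T_eq assoc theta_dot
        theta_theta)
qed

text \<open>For a representative \<open>x\<close>, which turns out to be idempotent, triviality on
  the class of \<open>f\<close> says that \<open>\<theta> (\<theta> x f)\<close> is the identity.
  This map is inverse to \<open>\<theta> x\<close>.\<close>

lemma retract_irretractable:
  assumes "u \<in> idempotents T (dot t)" "\<And>v. v \<in> T \<Longrightarrow> theta t u v = v"
  shows "u = cl f"
proof -
  have u: "u \<in> T" "dot t u u = u"
    using assms(1) by (simp_all only: idempotents_def mem_Collect_eq)
  then obtain x where x: "x \<in> S" "u = cl x"
    by (auto simp: T_eq)
  have "(x \<cdot> x, x) \<in> rel"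
    using u x by (simp flip: cl_eq_iff)
  then have "f \<cdot> x \<cdot> x = f \<cdot> x"
    using x by (simp add: rel_iff assoc)
  then have "f \<cdot> x = f"
    by (rule right_cancel[OF _ _ x(1), rotated 2]) (use x in simp_all)
  then have xE: "x \<in> E"
    using x ep_decomp[of f x] by (metis dot_idempotent E_carrier ep_E f_E)
  have "(\<theta> x f, f) \<in> rel"
    using assms(2)[of "cl f"] x by (simp add: T_eq flip: cl_eq_iff)
  then have 1: "\<theta> (\<theta> x f) z = z" if "z \<in> S" for z
    using that x by (simp add: rel_iff)
  have "\<theta> x z = z" if "z \<in> S" for z
    using 1[of "\<theta> x z"] theta_left_inverse[of x z] that x by simp
  then have "(x, f) \<in> rel"
    using x xE \<open>f \<cdot> x = f\<close> by (simp add: rel_iff)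
  then show ?thesis
    using x by (simp add: cl_eq_iff)
qed

section \<open>Coordinates of an irretractable solution\<close>

text \<open>\<open>1 \<circ> S\<close> is the orbit of \<open>1\<close> under the permutations \<open>\<theta>\<^sub>x\<close>.\<close>

lemma circ_image: "circ S s f ` S = {y \<in> S. \<exists>x\<in>S. \<theta> x y = f}"
proof (intro equalityI subsetI)
  fix y assume "y \<in> circ S s f ` S"
  then obtain z where z: "z \<in> S" "y = circ S s f z"
    by blast
  have "(z, f) \<in> s ` (S \<times> S)"
    using z bij_s by (simp add: bij_betw_def)
  then have "inv_into (S \<times> S) s (z, f) \<in> S \<times> S" "s (inv_into (S \<times> S) s (z, f)) = (z, f)"
    by (rule inv_into_into, rule f_inv_into_f)
  then show "y \<in> {y \<in> S. \<exists>x\<in>S. \<theta> x y = f}"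
    using z by (cases "inv_into (S \<times> S) s (z, f)") (auto simp: circ_def s_eq)
next
  fix y assume "y \<in> {y \<in> S. \<exists>x\<in>S. \<theta> x y = f}"
  then obtain x where x: "y \<in> S" "x \<in> S" "\<theta> x y = f"
    by blast
  have "inv_into (S \<times> S) s (s (x, y)) = (x, y)"
    using bij_s x by (intro inv_into_f_f) (auto simp: bij_betw_def)
  then have "circ S s f (x \<cdot> y) = y"
    using x by (simp add: circ_def s_eq)
  then show "y \<in> circ S s f ` S"
    using x by (metis dot_closed image_eqI)
qed

text \<open>For an idempotent \<open>y\<close> the element \<open>\<theta> y y\<close> acts
  trivially, hence is \<open>f\<close>, so \<open>y\<close> lies in the orbit of
  \<open>f\<close>.\<close>

lemma circ_image_eq_E:
  assumes "\<And>u. \<lbrakk>u \<in> E; \<And>v. v \<in> S \<Longrightarrow> \<theta> u v = v\<rbrakk> \<Longrightarrow> u = f"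
  shows "circ S s f ` S = E"
proof (intro equalityI subsetI)
  fix y assume "y \<in> circ S s f ` S"
  then obtain x where x: "y \<in> S" "x \<in> S" "\<theta> x y = f"
    by (auto simp: circ_image)
  then have "y = \<theta> (\<theta> x f) f"
    using theta_left_inverse by metis
  then show "y \<in> E"
    using x by simp
next
  fix y assume "y \<in> E"
  have "\<theta> y y = f"
    by (rule assms) (use \<open>y \<in> E\<close> theta_self_ker in simp_all)
  then show "y \<in> circ S s f ` S"
    using \<open>y \<in> E\<close> by (auto simp: circ_image)
qed

lemma components_eq:
  assumes "circ S s f ` S = E" "u \<in> S"
  shows "components S s e0 u = (ep u, f \<cdot> u)"
proof -
  have "unit_elt s e0 = f"
    by (simp add: unit_elt_def f_def)
  then have "p = (ep u, f \<cdot> u)"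
    if "fst p \<in> E" "snd p \<in> dot s f ` S" "u = fst p \<cdot> snd p" for p
    using that by (cases p) (auto simp flip: assoc)
  then show ?thesis
    unfolding components_def
    using assms
    by (intro the_equality)
      (auto simp: A_group_def G_group_def G_set_eq ep_decomp unit_elt_def simp flip: f_def)
qed

end

theorem theorem6p4:
  fixes S :: "'a set" and s :: "'a \<times> 'a \<Rightarrow> 'a \<times> 'a" and e0 :: 'a and e1 :: "'a set"
  assumes "finite_bijective_solution S s"
    and "e0 \<in> idempotents S (dot s)"
    and "e1 \<in> idempotents (retract S s e0) (dot (retract_map S s e0))"
  shows "let X = ker_theta S s \<inter> idempotents S (dot s);
             T = retract S s e0;
             t = retract_map S s e0
         in \<exists>\<phi>. (\<forall>a \<in> carrier (A_group T t e1). bij_betw (\<phi> a) X X) \<and>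
                (\<exists>F. identifies F S s (X \<times> T) (ext_map X \<phi> T t e1))"
proof -
  interpret pentagon_pointed S s e0
    using assms by unfold_locales
  interpret T: pentagon_pointed T t e1
    using retract_solution assms(3) by unfold_locales
  define X where "X = ker_theta S s \<inter> E"
  have X_iff: "x \<in> X \<longleftrightarrow> x \<in> E \<and> (\<forall>z\<in>S. \<theta> x z = z)" for x
    by (auto simp: X_def ker_theta_def)
  define r where "r y = \<theta> (ep y) (ep y)" for y
  define F where "F y = (r y, cl y)" for y
  have r_X: "r y \<in> X" if "y \<in> S" for y
    using that by (simp add: X_iff r_def theta_self_ker)
  have r_dot: "r (x \<cdot> y) = r x" if "x \<in> S" "y \<in> S" for x y
    using that by (simp add: r_def)
  have r_theta: "r (\<theta> x y) = r y" if "x \<in> S" "y \<in> S" for x y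
    using that theta_theta_E[of x "ep y" "ep y"] by (simp add: r_def)
  \<comment> \<open>\<open>T.f\<close> comes from the independent choice \<open>e1\<close>, but it
    is an idempotent acting trivially, so it too is the class of \<open>f\<close>.\<close>
  have circ_T: "circ T t T.f ` T = T.E"
    using retract_irretractable T.f_E T.theta_f by (intro T.circ_image_eq_E) metis
  \<comment> \<open>With identity permutations \<open>delta\<close> drops out; it remains to
    recombine the components of \<open>u\<close> and \<open>v\<close> into their product.\<close>
  have ext: "ext_map X (\<lambda>_. id) T t e1 ((\<alpha>, u), (\<beta>, v)) =
      ((\<alpha>, dot t u v), (\<beta>, theta t u v))"
    if "\<beta> \<in> X" "u \<in> T" "v \<in> T" for \<alpha> \<beta> u v
  proof -
    have "dot t (T.ep u) (dot t (dot t T.f u) (dot t T.f v)) = dot t u v"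
    proof -
      have "dot t (dot t T.f u) (dot t T.f v) = dot t T.f (dot t u v)"
        using that by (simp add: T.assoc[of T.f u] flip: T.assoc[of u T.f])
      then show ?thesis
        using that T.ep_decomp[of T.f "dot t u v"] by simp
    qed
    moreover have "inv_into X id \<beta> = \<beta>"
      using that inv_into_f_f[of id X \<beta>] by simp
    ultimately show ?thesis
      using that by (simp add: ext_map_def T.components_eq[OF circ_T] G_group_def)
  qed
  have "inj_on F S"
  proof (rule inj_onI)
    fix x y assume xy: "x \<in> S" "y \<in> S" "F x = F y"
    then have rel: "(x, y) \<in> rel" and r: "r x = r y"
      by (simp_all add: F_def flip: cl_eq_iff)
    \<comment> \<open>Related elements have idempotent parts with the same action, so
      \<open>r y\<close> may be computed with \<open>\<theta> (ep x)\<close>.\<close>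
    have *: "\<theta> (ep x) (ep x) = \<theta> (ep x) (ep y)"
      using rel r xy by (simp add: rel_iff r_def)
    have "ep x = ep y"
      by (rule theta_inj_E[OF _ _ _ *]) (use xy in simp_all)
    then show "x = y"
      using rel ep_decomp[OF f_E] xy by (metis rel_iff)
  qed
  moreover have "F ` S = X \<times> T"
  proof (intro equalityI subsetI)
    fix p assume "p \<in> X \<times> T"
    then obtain x y where p: "p = (x, cl y)" "x \<in> X" "y \<in> S"
      by (auto simp: T_eq)
    then have x: "x \<in> E" "\<And>z. z \<in> S \<Longrightarrow> \<theta> x z = z"
      by (auto simp: X_iff)
    \<comment> \<open>\<open>\<theta> \<gamma>\<close> is the inverse of
      \<open>\<theta> (ep y)\<close>. Moving \<open>x\<close> by it gives the point \<open>e\<close>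
      of the orbit of \<open>x\<close> that acts like \<open>ep y\<close>, and
      \<open>\<theta> e e = x\<close>; so \<open>e \<cdot> y\<close> is the required
      preimage.\<close>
    define \<gamma> where "\<gamma> = \<theta> (ep y) f"
    have \<gamma>: "\<gamma> \<in> S" "\<And>z. z \<in> S \<Longrightarrow> \<theta> (ep y) (\<theta> \<gamma> z) = z" "\<And>z. z \<in> S \<Longrightarrow> \<theta> \<gamma> (\<theta> (ep y) z) = z"
      using p theta_left_inverse theta_right_inverse by (simp_all add: \<gamma>_def)
    define e where "e = \<theta> \<gamma> x"
    have e: "e \<in> E"
      using \<gamma> x by (simp add: e_def)
    have "\<theta> e z = \<theta> (ep y) z" if "z \<in> S" for z
      using theta_theta_E[of \<gamma> x "\<theta> (ep y) z"] \<gamma> x that p by (simp add: e_def)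
    then have "cl (e \<cdot> y) = cl y" "r (e \<cdot> y) = x"
      using p e x \<gamma> by (simp_all add: cl_eq_iff rel_iff r_def flip: assoc) (simp add: e_def)
    then show "p \<in> F ` S"
      using p e by (metis F_def image_eqI dot_closed E_carrier)
  qed (auto simp: F_def r_X T_eq)
  moreover have "ext_map X (\<lambda>_. id) T t e1 (F x, F y) = map_prod F F (s (x, y))"
    if "x \<in> S" "y \<in> S" for x y
    using that by (simp add: F_def ext r_X s_eq r_dot r_theta)
  ultimately have "identifies F S s (X \<times> T) (ext_map X (\<lambda>_. id) T t e1)"
    by (simp add: identifies_def bij_betw_def)
  then show ?thesis
    unfolding Let_def X_def[symmetric] by (intro exI[of _ "\<lambda>_. id"]) auto
qed

end
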